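(* Let $1\le p\le\infty$ and let $f\in L_p[0,1]$ be a self-similar function of zero spectral order with parameters $n,a_k,d_k,\beta_k$, let $\hat k$ be the unique index with $d_{\hat k}\neq0$, and suppose that $\hat G_{\hat k}=\tilde G_{\hat k}$ (orientation reversing). Then the special point $\hat x$ of $f$ has the coordinate $$\hat x=\frac{\alpha_{\hat k+1}}{1+a_{\hat k}}.$$ Moreover, whatever the value of $\hat k$, the point $\hat x$ does not coincide with an endpoint of $[0,1]$.
   Context: Similarity operators. Fix an integer $n>1$, real numbers $a_k>0$ ($k=1,\dots,n$) with $\sum_{k=1}^n a_k=1$, and real numbers $d_k,\beta_k$ ($k=1,\dots,n$). Put $\alpha_1=0$ and $\alpha_k=\sum_{l=1}^{k-1}a_l$ for $k=2,\dots,n+1$, so that $0=\alpha_1<\dots<\alpha_{n+1}=1$. For $f\in L_p[0,1]$ and $x\in[\alpha_k,\alpha_{k+1}]$ put $G_k(f)(x)=f\big((x-\alpha_k)/a_k\big)$ (orientation preserving) and $\tilde G_k(f)(x)=f\big((\alpha_{k+1}-x)/a_k\big)$ (orientation reversing); both are regarded as zero outside $[\alpha_k,\alpha_{k+1}]$. For each $k$ let $\hat G_k$ be either $G_k$ or $\tilde G_k$. The similarity operator $G:L_p[0,1]\to L_p[0,1]$ is $$G(f)=\sum_{k=1}^n\left\{\beta_k\,\chi_{(\alpha_k,\alpha_{k+1})}+d_k\,\hat G_k(f)\right\},$$ where $\chi$ denotes a characteristic function. Standing assumptions. $G$ is a contraction in $L_p[0,1]$: $\sum_{k=1}^n a_k|d_k|^p<1$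 if $1\le p<\infty$, respectively $\max_k|d_k|<1$ if $p=\infty$. At least one of the $\beta_k$ is nonzero. A function $f\in L_p[0,1]$ is self-similar if $G(f)=f$ for such a $G$ (the fixed point is unique). It is called a self-similar function of zero spectral order if exactly one of the numbers $d_1,\dots,d_n$ is nonzero. Special point. When $\hat G_{\hat k}=\tilde G_{\hat k}$, let $S(x)=-a_{\hat k}x+\alpha_{\hat k+1}$ be the associated affine map of $[0,1]$ onto $[\alpha_{\hat k},\alpha_{\hat k+1}]$. The special point $\hat x$ of $f$ is the unique common point of the nested intervals $S^m([0,1])$, $m=1,2,\dots$, where $S^m$ is the $m$-th iterate of $S$. *)

theory Defs
  imports "HOL-Analysis.Analysis"
begin

text \<open>
  Elements of \<open>L\<^sub>p[0,1]\<close> are represented by real functions on the line, identified when they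
  agree almost everywhere on \<open>[0,1]\<close>; their values outside \<open>[0,1]\<close> are irrelevant.  The
  exponent ranges over \<^typ>\<open>ennreal\<close>, with \<open>p = \<infinity>\<close> allowed.  All sequences of parameters are
  indexed by \<open>{1..n}\<close>; their values at other indices are irrelevant.
\<close>

definition in_Lp01 :: "ennreal \<Rightarrow> (real \<Rightarrow> real) \<Rightarrow> bool" where
  "in_Lp01 p f \<longleftrightarrow>
     f \<in> borel_measurable (lebesgue_on {0..1}) \<and>
     (if p = \<infinity> then \<exists>C. AE x in lebesgue_on {0..1}. \<bar>f x\<bar> \<le> C
      else integrable (lebesgue_on {0..1}) (\<lambda>x. \<bar>f x\<bar> powr enn2real p))"

definition alpha :: "(nat \<Rightarrow> real) \<Rightarrow> nat \<Rightarrow> real" where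
  "alpha a k = (\<Sum>l\<in>{1..<k}. a l)"

definition G_pres :: "(nat \<Rightarrow> real) \<Rightarrow> nat \<Rightarrow> (real \<Rightarrow> real) \<Rightarrow> real \<Rightarrow> real" where
  "G_pres a k f x =
     (if x \<in> {alpha a k..alpha a (k + 1)} then f ((x - alpha a k) / a k) else 0)"

definition G_rev :: "(nat \<Rightarrow> real) \<Rightarrow> nat \<Rightarrow> (real \<Rightarrow> real) \<Rightarrow> real \<Rightarrow> real" where
  "G_rev a k f x =
     (if x \<in> {alpha a k..alpha a (k + 1)} then f ((alpha a (k + 1) - x) / a k) else 0)"

text \<open>\<open>flip k\<close> says that the \<open>k\<close>-th piece is orientation reversing.\<close>

definition similarity_op ::
  "nat \<Rightarrow> (nat \<Rightarrow> real) \<Rightarrow> (nat \<Rightarrow> real) \<Rightarrow> (nat \<Rightarrow> real) \<Rightarrow> (nat \<Rightarrow> bool)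
    \<Rightarrow> (real \<Rightarrow> real) \<Rightarrow> real \<Rightarrow> real" where
  "similarity_op n a d \<beta> flip f x =
     (\<Sum>k=1..n. \<beta> k * indicator {alpha a k<..<alpha a (k + 1)} x
               + d k * (if flip k then G_rev a k f x else G_pres a k f x))"

definition contraction_cond ::
  "ennreal \<Rightarrow> nat \<Rightarrow> (nat \<Rightarrow> real) \<Rightarrow> (nat \<Rightarrow> real) \<Rightarrow> bool" where
  "contraction_cond p n a d \<longleftrightarrow>
     (if p = \<infinity> then Max ((\<lambda>k. \<bar>d k\<bar>) ` {1..n}) < 1
      else (\<Sum>k=1..n. a k * \<bar>d k\<bar> powr enn2real p) < 1)"

definition similarity_params ::
  "ennreal \<Rightarrow> nat \<Rightarrow> (nat \<Rightarrow> real) \<Rightarrow> (nat \<Rightarrow> real) \<Rightarrow> (nat \<Rightarrow> real) \<Rightarrow> bool" where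
  "similarity_params p n a d \<beta> \<longleftrightarrow>
     n > 1 \<and> (\<forall>k\<in>{1..n}. a k > 0) \<and> (\<Sum>k=1..n. a k) = 1 \<and>
     contraction_cond p n a d \<and> (\<exists>k\<in>{1..n}. \<beta> k \<noteq> 0)"

definition self_similar ::
  "ennreal \<Rightarrow> nat \<Rightarrow> (nat \<Rightarrow> real) \<Rightarrow> (nat \<Rightarrow> real) \<Rightarrow> (nat \<Rightarrow> real) \<Rightarrow> (nat \<Rightarrow> bool)
    \<Rightarrow> (real \<Rightarrow> real) \<Rightarrow> bool" where
  "self_similar p n a d \<beta> flip f \<longleftrightarrow>
     similarity_params p n a d \<beta> \<and> in_Lp01 p f \<and>
     (AE x in lebesgue_on {0..1}. similarity_op n a d \<beta> flip f x = f x)"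

definition zero_spectral_order ::
  "ennreal \<Rightarrow> nat \<Rightarrow> (nat \<Rightarrow> real) \<Rightarrow> (nat \<Rightarrow> real) \<Rightarrow> (nat \<Rightarrow> real) \<Rightarrow> (nat \<Rightarrow> bool)
    \<Rightarrow> (real \<Rightarrow> real) \<Rightarrow> bool" where
  "zero_spectral_order p n a d \<beta> flip f \<longleftrightarrow>
     self_similar p n a d \<beta> flip f \<and> (\<exists>!k. k \<in> {1..n} \<and> d k \<noteq> 0)"

definition S_rev :: "(nat \<Rightarrow> real) \<Rightarrow> nat \<Rightarrow> real \<Rightarrow> real" where
  "S_rev a k x = - a k * x + alpha a (k + 1)"

text \<open>The special point depends on \<open>f\<close> only through the parameters of its similarity operator.\<close>

definition special_point :: "(nat \<Rightarrow> real) \<Rightarrow> nat \<Rightarrow> real" where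
  "special_point a k = (THE x. \<forall>m\<ge>1. x \<in> (S_rev a k ^^ m) ` {0..1})"

end

theory Submission
  imports Defs
begin

text \<open>
  The map \<^term>\<open>S_rev a k\<close> is affine with slope \<^term>\<open>- a k\<close>, so in the coordinate centred at its
  fixed point \<open>c = \<alpha>\<^sub>k\<^sub>+\<^sub>1 / (1 + a\<^sub>k)\<close> it is multiplication by \<^term>\<open>- a k\<close>, and the \<open>m\<close>-th
  iterate is multiplication by \<open>(- a\<^sub>k)\<^sup>m\<close> (\<open>S_rev_funpow\<close>).  The point \<open>c\<close> lies in every
  image of \<open>[0,1]\<close> because it is fixed, and nothing else does because \<open>a\<^sub>k < 1\<close> makes the images
  shrink to it (\<open>special_point_eq\<close>).

  For the parameters of a similarity operator \<open>a\<^sub>k < 1\<close> holds because there are at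
  least two pieces of positive length, and \<open>0 < \<alpha>\<^sub>k\<^sub>+\<^sub>1 \<le> 1\<close> because the lengths add up to
  \<open>1\<close>.  Since \<open>1 + a\<^sub>k > 1\<close>, dividing by it keeps \<open>c\<close> strictly between \<open>0\<close> and \<open>1\<close>.
\<close>

lemma S_rev_funpow:
  assumes "1 + a k \<noteq> 0"
  defines "c \<equiv> alpha a (k + 1) / (1 + a k)"
  shows "(S_rev a k ^^ m) x = c + (- a k) ^ m * (x - c)"
proof -
  have "alpha a (k + 1) = c * (1 + a k)"
    using assms by simp
  then have S: "S_rev a k y = c + - a k * (y - c)" for y
    unfolding S_rev_def by (simp only:) (simp add: algebra_simps)
  show ?thesis
    by (induction m) (simp_all add: S)
qed

text \<open>
  The two bounds on \<^term>\<open>alpha a (k + 1)\<close> say that the fixed point lies in \<open>[0,1]\<close>.  Then every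
  point of \<open>S\<^sup>m([0,1])\<close> is within \<open>a\<^sub>k\<^sup>m\<close> of it, which leaves it as the only common point.
\<close>
lemma special_point_eq:
  assumes "0 < a k" "a k < 1" "0 \<le> alpha a (k + 1)" "alpha a (k + 1) \<le> 1 + a k"
  shows "special_point a k = alpha a (k + 1) / (1 + a k)"
proof -
  define c where "c = alpha a (k + 1) / (1 + a k)"
  have c01: "c \<in> {0..1}"
    using assms by (simp add: c_def)
  have iter: "(S_rev a k ^^ m) x = c + (- a k) ^ m * (x - c)" for m x
    using S_rev_funpow[of a k] assms(1) by (simp add: c_def)
  show ?thesis
    unfolding special_point_def c_def[symmetric]
  proof (rule the_equality)
    show "\<forall>m\<ge>1. c \<in> (S_rev a k ^^ m) ` {0..1}"
    proof (intro allI impI)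
      fix m
      have "(S_rev a k ^^ m) c = c"
        by (simp add: iter)
      then show "c \<in> (S_rev a k ^^ m) ` {0..1}"
        using c01 by (metis imageI)
    qed
  next
    fix x
    assume x: "\<forall>m\<ge>1. x \<in> (S_rev a k ^^ m) ` {0..1}"
    have bound: "\<bar>x - c\<bar> \<le> a k ^ m" if "m \<ge> 1" for m
    proof -
      obtain y where y: "y \<in> {0..1}" "x = c + (- a k) ^ m * (y - c)"
        using x[rule_format, OF \<open>m \<ge> 1\<close>] unfolding iter by blast
      have "\<bar>x - c\<bar> = a k ^ m * \<bar>y - c\<bar>"
        using y(2) assms(1) by (simp add: abs_mult power_abs)
      also have "\<dots> \<le> a k ^ m * 1"
        using y(1) c01 assms(1) by (intro mult_left_mono) auto
      finally show ?thesis by simp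
    qed
    have "(\<lambda>m. a k ^ m) \<longlonglongrightarrow> 0"
      using assms(1,2) by (intro LIMSEQ_realpow_zero) auto
    then have "\<bar>x - c\<bar> \<le> 0"
      using bound by (intro LIMSEQ_le_const) auto
    then show "x = c" by simp
  qed
qed

theorem mainTheorem5:
  fixes p :: ennreal and n khat :: nat and a d \<beta> :: "nat \<Rightarrow> real"
    and flip :: "nat \<Rightarrow> bool" and f :: "real \<Rightarrow> real"
  assumes "1 \<le> p"
    and "zero_spectral_order p n a d \<beta> flip f"
    and "khat \<in> {1..n}" and "d khat \<noteq> 0"
    and "flip khat"
  shows "special_point a khat = alpha a (khat + 1) / (1 + a khat)
       \<and> special_point a khat \<noteq> 0 \<and> special_point a khat \<noteq> 1"
proof -
  have n: "n > 1" and pos: "\<And>k. k \<in> {1..n} \<Longrightarrow> a k > 0" and total: "(\<Sum>k=1..n. a k) = 1"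
    using assms(2)
    by (auto simp: zero_spectral_order_def self_similar_def similarity_params_def)
  have a_pos: "0 < a khat"
    using pos assms(3) by simp
  have a_less: "a khat < 1"
  proof -
    obtain j where j: "j \<in> {1..n}" "j \<noteq> khat"
    proof (cases "khat = 1")
      case True
      then show ?thesis using n by (intro that[of 2]) auto
    next
      case False
      then show ?thesis using n by (intro that[of 1]) auto
    qed
    have "sum a {khat} < sum a {1..n}"
      using j pos assms(3) by (intro sum_strict_mono2[of _ _ j]) (auto intro: less_imp_le)
    then show ?thesis using total by simp
  qed
  have alpha_pos: "0 < alpha a (khat + 1)"
    unfolding alpha_def using assms(3) by (intro sum_pos pos) auto
  have alpha_le: "alpha a (khat + 1) \<le> 1"
    unfolding alpha_def total[symmetric]
    using assms(3) by (intro sum_mono2) (auto intro!: less_imp_le[OF pos])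
  have eq: "special_point a khat = alpha a (khat + 1) / (1 + a khat)"
    using a_pos a_less alpha_pos alpha_le by (intro special_point_eq) auto
  have "0 < special_point a khat" "special_point a khat < 1"
    unfolding eq using a_pos alpha_pos alpha_le by simp_all
  then have "special_point a khat \<noteq> 0" "special_point a khat \<noteq> 1"
    by linarith+
  with eq show ?thesis by blast
qed

end
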